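(* Every Past LTL formula admits an equivalent program of $\mathcal{L}(\mathcal{S})$ of linear size (i.e., of size linear in the size of the formula).
   Context: Past LTL formulas are built from propositional variables, the constants $\top,\bot$, the Boolean operators $\neg,\land,\lor$, the before operator $\ominus$ (with $I,t \models \ominus\alpha$ iff $I,t-1\models\alpha$) and the since operator $\mathsf{S}$ (with $I,t \models \alpha\,\mathsf{S}\,\beta$ iff there is $j\in[1,t]$ with $I,j\models\beta$ and $I,k\models\alpha$ for all $k\in[j+1,t]$), interpreted over finite non-empty sequences $I=I_1\dots I_\ell$ of sets of propositional variables. A (temporal) program is a finite, nonrecursive (acyclic dependency graph), definitorial (each variable defined by at most one rule) set of rules of three kinds: static rules $p \;{:}{-}\; \alpha$ with $\alpha$ a static (Boolean) formula; delay rules $p \;{:}{-}\; \ominus q$; and dynamic rules $p_1,\dots,p_n \;{:}{-}\; \mathcal{A}(a_1,\dots,a_m)$, where $\mathcal{A}=\langle \mathbb{B}^m,[1,n],\delta,q_\mathrm{init}\rangle$ is an operator automaton (a semiautomaton on assignments with an initial state). Semantics: a variable defined by a static rule holds at $t$ iff its body holds at $t$; one defined by a delay rule holds at $t$ iff $q$ holds at $t-1$; for a dynamic rule, $p_i$ holds at time $0$ iff $q_\mathrm{init}=i$, and at $t>0$ iff for some $j$ and some assignment $\sigma$ to $a_1,\dots,a_m$ we have $\delta(j,\sigma)=i$, $p_j$ holds at $t-1$ and $\sigma$ holds at $t$ (so the head variables give a one-hot encoding of the automaton state). $\mathcal{L}(\mathcal{S})$ is the set of programs using static rules, delay rules, and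 dynamic rules whose operator is the since automaton $\mathcal{S}=\langle\mathbb{B}^2,\{1,2\},\delta,1\rangle$ with $\delta(q,10)=q$, $\delta(q,01)=\delta(q,11)=2$, $\delta(q,00)=1$ (inputs given as values of $(a,b)$), so that $a\,\mathsf{S}\,b$ corresponds to $q_2$ in the rule $q_1,q_2 \;{:}{-}\; \mathcal{S}(a,b)$. Equivalence of a formula $\varphi$ and a program $P$ means that for some variable $p$ of $P$, $(P,I,t)\models p$ iff $I,t\models\varphi$ for all interpretations $I$ and times $t$. *)

theory Defs
  imports Main
begin

section \<open>Interpretations\<close>

text \<open>
  An interpretation \<open>I\<^sub>1 \<dots> I\<^sub>l\<close> is a non-empty list, with \<open>I\<^sub>t\<close> at list index \<open>t - 1\<close>.
  There is no letter at time 0 or after time \<open>l\<close>, so no variable is read as true there.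
\<close>

type_synonym 'v interp = "'v set list"

definition letter :: "'v interp \<Rightarrow> nat \<Rightarrow> 'v set" where
  "letter I t = (if t \<in> {1..length I} then I ! (t - 1) else {})"


section \<open>Past LTL\<close>

datatype 'v pltl =
    Var 'v
  | Top
  | Bot
  | Neg "'v pltl"
  | Conj "'v pltl" "'v pltl"
  | Disj "'v pltl" "'v pltl"
  | Before "'v pltl"
  | Since "'v pltl" "'v pltl"

text \<open>
  Satisfaction is meant for the positions \<open>1, \<dots>, l\<close> of an interpretation. There is no position
  0, hence a before formula is false at time 1; the clauses never consult the value at 0.
\<close>

primrec pltl_sat :: "'v interp \<Rightarrow> nat \<Rightarrow> 'v pltl \<Rightarrow> bool" where
  "pltl_sat I t (Var p) \<longleftrightarrow> p \<in> letter I t"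
| "pltl_sat I t Top \<longleftrightarrow> True"
| "pltl_sat I t Bot \<longleftrightarrow> False"
| "pltl_sat I t (Neg \<alpha>) \<longleftrightarrow> \<not> pltl_sat I t \<alpha>"
| "pltl_sat I t (Conj \<alpha> \<beta>) \<longleftrightarrow> pltl_sat I t \<alpha> \<and> pltl_sat I t \<beta>"
| "pltl_sat I t (Disj \<alpha> \<beta>) \<longleftrightarrow> pltl_sat I t \<alpha> \<or> pltl_sat I t \<beta>"
| "pltl_sat I t (Before \<alpha>) \<longleftrightarrow> t > 1 \<and> pltl_sat I (t - 1) \<alpha>"
| "pltl_sat I t (Since \<alpha> \<beta>) \<longleftrightarrow>
     (\<exists>j\<in>{1..t}. pltl_sat I j \<beta> \<and> (\<forall>k\<in>{j+1..t}. pltl_sat I k \<alpha>))"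

primrec pltl_size :: "'v pltl \<Rightarrow> nat" where
  "pltl_size (Var p) = 1"
| "pltl_size Top = 1"
| "pltl_size Bot = 1"
| "pltl_size (Neg \<alpha>) = 1 + pltl_size \<alpha>"
| "pltl_size (Conj \<alpha> \<beta>) = 1 + pltl_size \<alpha> + pltl_size \<beta>"
| "pltl_size (Disj \<alpha> \<beta>) = 1 + pltl_size \<alpha> + pltl_size \<beta>"
| "pltl_size (Before \<alpha>) = 1 + pltl_size \<alpha>"
| "pltl_size (Since \<alpha> \<beta>) = 1 + pltl_size \<alpha> + pltl_size \<beta>"


section \<open>Static formulas\<close>

datatype 'v static =
    SVar 'v
  | STop
  | SBot
  | SNeg "'v static"
  | SConj "'v static" "'v static"
  | SDisj "'v static" "'v static"

primrec static_sat :: "'v set \<Rightarrow> 'v static \<Rightarrow> bool" where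
  "static_sat V (SVar p) \<longleftrightarrow> p \<in> V"
| "static_sat V STop \<longleftrightarrow> True"
| "static_sat V SBot \<longleftrightarrow> False"
| "static_sat V (SNeg \<alpha>) \<longleftrightarrow> \<not> static_sat V \<alpha>"
| "static_sat V (SConj \<alpha> \<beta>) \<longleftrightarrow> static_sat V \<alpha> \<and> static_sat V \<beta>"
| "static_sat V (SDisj \<alpha> \<beta>) \<longleftrightarrow> static_sat V \<alpha> \<or> static_sat V \<beta>"

primrec static_size :: "'v static \<Rightarrow> nat" where
  "static_size (SVar p) = 1"
| "static_size STop = 1"
| "static_size SBot = 1"
| "static_size (SNeg \<alpha>) = 1 + static_size \<alpha>"
| "static_size (SConj \<alpha> \<beta>) = 1 + static_size \<alpha> + static_size \<beta>"
| "static_size (SDisj \<alpha> \<beta>) = 1 + static_size \<alpha> + static_size \<beta>"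


section \<open>Operator automata\<close>

text \<open>
  The states are \<open>1, \<dots>, num_states\<close>; an input letter is a Boolean list of length \<open>arity\<close>.
\<close>

record operator_automaton =
  arity :: nat
  num_states :: nat
  delta :: "nat \<Rightarrow> bool list \<Rightarrow> nat"
  init :: nat

definition wf_automaton :: "operator_automaton \<Rightarrow> bool" where
  "wf_automaton A \<longleftrightarrow>
     init A \<in> {1..num_states A} \<and>
     (\<forall>q\<in>{1..num_states A}. \<forall>\<sigma>. length \<sigma> = arity A \<longrightarrow> delta A q \<sigma> \<in> {1..num_states A})"

fun since_delta :: "nat \<Rightarrow> bool list \<Rightarrow> nat" where
  "since_delta q [True, False] = q"
| "since_delta q [False, True] = 2"
| "since_delta q [True, True] = 2"
| "since_delta q [False, False] = 1"

definition since_automaton :: operator_automaton where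
  "since_automaton = \<lparr>arity = 2, num_states = 2, delta = since_delta, init = 1\<rparr>"


section \<open>Programs\<close>

datatype 'v rule =
    Static 'v "'v static"
  | Delay 'v 'v
  | Dynamic "'v list" operator_automaton "'v list"

primrec head_vars :: "'v rule \<Rightarrow> 'v set" where
  "head_vars (Static p \<alpha>) = {p}"
| "head_vars (Delay p q) = {p}"
| "head_vars (Dynamic ps A as) = set ps"

primrec body_vars :: "'v rule \<Rightarrow> 'v set" where
  "body_vars (Static p \<alpha>) = set_static \<alpha>"
| "body_vars (Delay p q) = {q}"
| "body_vars (Dynamic ps A as) = set as"

primrec rule_wf :: "'v rule \<Rightarrow> bool" where
  "rule_wf (Static p \<alpha>) \<longleftrightarrow> True"
| "rule_wf (Delay p q) \<longleftrightarrow> True"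
| "rule_wf (Dynamic ps A as) \<longleftrightarrow>
     wf_automaton A \<and> length ps = num_states A \<and> distinct ps \<and> length as = arity A"

definition defined_vars :: "'v rule set \<Rightarrow> 'v set" where
  "defined_vars P = (\<Union>r\<in>P. head_vars r)"

definition prog_vars :: "'v rule set \<Rightarrow> 'v set" where
  "prog_vars P = (\<Union>r\<in>P. head_vars r \<union> body_vars r)"

definition dependency_graph :: "'v rule set \<Rightarrow> ('v \<times> 'v) set" where
  "dependency_graph P = (\<Union>r\<in>P. body_vars r \<times> head_vars r)"

definition nonrecursive :: "'v rule set \<Rightarrow> bool" where
  "nonrecursive P \<longleftrightarrow> acyclic (dependency_graph P)"

definition definitorial :: "'v rule set \<Rightarrow> bool" where
  "definitorial P \<longleftrightarrow> (\<forall>r\<in>P. \<forall>r'\<in>P. r \<noteq> r' \<longrightarrow> head_vars r \<inter> head_vars r' = {})"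

definition program :: "'v rule set \<Rightarrow> bool" where
  "program P \<longleftrightarrow> finite P \<and> (\<forall>r\<in>P. rule_wf r) \<and> nonrecursive P \<and> definitorial P"

text \<open>
  The operator of a dynamic rule counts as one symbol: a fixed finite set of operators, as below,
  makes the description of an automaton contribute a constant factor only.
\<close>

primrec rule_size :: "'v rule \<Rightarrow> nat" where
  "rule_size (Static p \<alpha>) = 1 + static_size \<alpha>"
| "rule_size (Delay p q) = 3"
| "rule_size (Dynamic ps A as) = length ps + 1 + length as"

definition prog_size :: "'v rule set \<Rightarrow> nat" where
  "prog_size P = (\<Sum>r\<in>P. rule_size r)"

definition programs_over :: "operator_automaton set \<Rightarrow> 'v rule set set" where
  "programs_over \<A> = {P. program P \<and> (\<forall>ps A as. Dynamic ps A as \<in> P \<longrightarrow> A \<in> \<A>)}"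


section \<open>Semantics of programs\<close>

text \<open>
  A valuation \<open>v\<close> gives the set of variables holding at each time. Time 0, which precedes the
  first letter, is included: it is where dynamic rules are initialised. Static rules apply at time
  0 as at any other time, while a delay rule derives nothing at time 0.
\<close>

primrec obeys :: "(nat \<Rightarrow> 'v set) \<Rightarrow> 'v rule \<Rightarrow> bool" where
  "obeys v (Static p \<alpha>) \<longleftrightarrow> (\<forall>t. p \<in> v t \<longleftrightarrow> static_sat (v t) \<alpha>)"
| "obeys v (Delay p q) \<longleftrightarrow> (\<forall>t. p \<in> v t \<longleftrightarrow> t > 0 \<and> q \<in> v (t - 1))"
| "obeys v (Dynamic ps A as) \<longleftrightarrow>
     (\<forall>i\<in>{1..num_states A}.
        (ps ! (i - 1) \<in> v 0 \<longleftrightarrow> init A = i) \<and>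
        (\<forall>t>0. ps ! (i - 1) \<in> v t \<longleftrightarrow>
          (\<exists>j\<in>{1..num_states A}. \<exists>\<sigma>. length \<sigma> = arity A \<and> delta A j \<sigma> = i \<and>
             ps ! (j - 1) \<in> v (t - 1) \<and> (\<forall>k<arity A. \<sigma> ! k \<longleftrightarrow> as ! k \<in> v t))))"

definition prog_model :: "'v rule set \<Rightarrow> 'v interp \<Rightarrow> (nat \<Rightarrow> 'v set) \<Rightarrow> bool" where
  "prog_model P I v \<longleftrightarrow>
     (\<forall>p. p \<notin> defined_vars P \<longrightarrow> (\<forall>t. p \<in> v t \<longleftrightarrow> p \<in> letter I t)) \<and> (\<forall>r\<in>P. obeys v r)"

lemma static_sat_cong:
  "(\<And>p. p \<in> set_static \<alpha> \<Longrightarrow> p \<in> V \<longleftrightarrow> p \<in> W) \<Longrightarrow> static_sat V \<alpha> \<longleftrightarrow> static_sat W \<alpha>"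
  by (induction \<alpha>) auto

lemma wf_dependency_graph:
  assumes "program P"
  shows "wf (dependency_graph P)"
proof (rule finite_acyclic_wf)
  have "finite (head_vars r)" "finite (body_vars r)" for r :: "'a rule"
  proof -
    have "finite (set_static \<alpha>)" for \<alpha> :: "'a static" by (induction \<alpha>) auto
    then show "finite (head_vars r)" "finite (body_vars r)" by (cases r; simp)+
  qed
  then show "finite (dependency_graph P)"
    using assms by (auto simp: program_def dependency_graph_def)
  show "acyclic (dependency_graph P)"
    using assms by (simp add: program_def nonrecursive_def)
qed

lemma prog_model_unique:
  assumes P: "program P" and v: "prog_model P I v" and w: "prog_model P I w"
  shows "v = w"
proof -
  have "\<forall>t. p \<in> v t \<longleftrightarrow> p \<in> w t" for p
    using wf_dependency_graph[OF P]
  proof (induction p rule: wf_induct_rule)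
    case (less p)
    show ?case
    proof (cases "p \<in> defined_vars P")
      case False
      then show ?thesis using v w by (simp add: prog_model_def)
    next
      case True
      then obtain r where r: "r \<in> P" "p \<in> head_vars r" by (auto simp: defined_vars_def)
      have body: "q \<in> v t \<longleftrightarrow> q \<in> w t" if "q \<in> body_vars r" for q t
        using less[of q] that r by (auto simp: dependency_graph_def)
      have ov: "obeys v r" and ow: "obeys w r" using v w r by (auto simp: prog_model_def)
      show ?thesis
      proof (cases r)
        case (Static p' \<alpha>)
        have "static_sat (v t) \<alpha> \<longleftrightarrow> static_sat (w t) \<alpha>" for t
          by (rule static_sat_cong) (use body Static in auto)
        then show ?thesis using ov ow r Static by simp
      next
        case (Delay p' q)
        then show ?thesis using ov ow r body by simp
      next
        case (Dynamic ps A as)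
        have len: "length ps = num_states A" "length as = arity A"
          using P r Dynamic by (auto simp: program_def)
        have args: "as ! k \<in> v t \<longleftrightarrow> as ! k \<in> w t" if "k < arity A" for k t
          using body Dynamic len that by simp
        have "\<forall>i\<in>{1..num_states A}. ps ! (i - 1) \<in> v t \<longleftrightarrow> ps ! (i - 1) \<in> w t" for t
        proof (induction t)
          case 0
          then show ?case using ov ow Dynamic by simp
        next
          case (Suc t)
          show ?case
          proof
            fix i assume i: "i \<in> {1..num_states A}"
            let ?step = "\<lambda>u. \<exists>j\<in>{1..num_states A}. \<exists>\<sigma>. length \<sigma> = arity A \<and> delta A j \<sigma> = i \<and>
              ps ! (j - 1) \<in> u t \<and> (\<forall>k<arity A. \<sigma> ! k \<longleftrightarrow> as ! k \<in> u (Suc t))"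
            have "ps ! (i - 1) \<in> v (Suc t) \<longleftrightarrow> ?step v" "ps ! (i - 1) \<in> w (Suc t) \<longleftrightarrow> ?step w"
              using ov ow Dynamic i by auto
            moreover have "?step v \<longleftrightarrow> ?step w"
              using Suc args by (intro bex_cong) auto
            ultimately show "ps ! (i - 1) \<in> v (Suc t) \<longleftrightarrow> ps ! (i - 1) \<in> w (Suc t)" by blast
          qed
        qed
        moreover obtain k where k: "k < length ps" "p = ps ! (Suc k - 1)"
          using r Dynamic by (auto simp: in_set_conv_nth)
        moreover have "Suc k \<in> {1..num_states A}" using k len by simp
        ultimately show ?thesis by blast
      qed
    qed
  qed
  then show ?thesis by auto
qed

primrec dynamic_run :: "operator_automaton \<Rightarrow> (nat \<Rightarrow> bool list) \<Rightarrow> nat \<Rightarrow> nat" where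
  "dynamic_run A x 0 = init A"
| "dynamic_run A x (Suc t) = delta A (dynamic_run A x t) (x (Suc t))"

fun rule_eval :: "('v \<Rightarrow> nat \<Rightarrow> bool) \<Rightarrow> 'v \<Rightarrow> 'v rule \<Rightarrow> nat \<Rightarrow> bool" where
  "rule_eval f p (Static p' \<alpha>) t = static_sat {q. f q t} \<alpha>"
| "rule_eval f p (Delay p' q) t = (t > 0 \<and> f q (t - 1))"
| "rule_eval f p (Dynamic ps A as) t =
     (\<exists>i\<in>{1..num_states A}. p = ps ! (i - 1) \<and> dynamic_run A (\<lambda>t. map (\<lambda>a. f a t) as) t = i)"

lemma rule_eval_cong:
  assumes "\<And>q. q \<in> body_vars r \<Longrightarrow> f q = g q"
  shows "rule_eval f p r t = rule_eval g p r t"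
proof (cases r)
  case (Static p' \<alpha>)
  have "static_sat {q. f q t} \<alpha> = static_sat {q. g q t} \<alpha>"
    by (rule static_sat_cong) (use assms Static in auto)
  then show ?thesis using Static by simp
next
  case (Dynamic ps A as)
  have "(\<lambda>t. map (\<lambda>a. f a t) as) = (\<lambda>t. map (\<lambda>a. g a t) as)"
    using assms Dynamic by auto
  then show ?thesis using Dynamic by simp
qed (use assms in auto)

lemma prog_model_exists:
  fixes P :: "'v rule set"
  assumes P: "program P"
  shows "\<exists>v. prog_model P I v"
proof -
  let ?R = "dependency_graph P"
  let ?rule = "\<lambda>p. THE r. r \<in> P \<and> p \<in> head_vars r"
  define F where "F = (\<lambda>(f :: 'v \<Rightarrow> nat \<Rightarrow> bool) p t.
    if p \<in> defined_vars P then rule_eval f p (?rule p) t else p \<in> letter I t)"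
  define g where "g = wfrec ?R F"
  have the_rule: "?rule p = r" if "r \<in> P" "p \<in> head_vars r" for p r
    using P that by (intro the_equality) (auto simp: program_def definitorial_def)
  have g: "g p t = rule_eval g p r t" if r: "r \<in> P" "p \<in> head_vars r" for p r t
  proof -
    have "g p = F (cut g ?R p) p" unfolding g_def by (rule wfrec[OF wf_dependency_graph[OF P]])
    moreover have "p \<in> defined_vars P" using r by (auto simp: defined_vars_def)
    moreover have "rule_eval (cut g ?R p) p r t = rule_eval g p r t"
      by (rule rule_eval_cong) (use r in \<open>auto simp: cut_def dependency_graph_def\<close>)
    ultimately show ?thesis using the_rule[OF r] by (simp add: F_def)
  qed
  have input: "g p t \<longleftrightarrow> p \<in> letter I t" if "p \<notin> defined_vars P" for p t
    using that wfrec[OF wf_dependency_graph[OF P], of F p] by (simp add: g_def F_def)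
  have "obeys (\<lambda>t. {p. g p t}) r" if r: "r \<in> P" for r
  proof (cases r)
    case (Static p \<alpha>)
    then show ?thesis using g[OF r] by simp
  next
    case (Delay p q)
    then show ?thesis using g[OF r] by simp
  next
    case (Dynamic ps A as)
    have wfr: "wf_automaton A" "length ps = num_states A" "distinct ps" "length as = arity A"
      using P r Dynamic by (auto simp: program_def)
    let ?x = "\<lambda>t. map (\<lambda>a. g a t) as"
    let ?q = "dynamic_run A ?x"
    have q: "?q t \<in> {1..num_states A}" for t
    proof (induction t)
      case 0
      show ?case using wfr by (simp add: wf_automaton_def)
    next
      case (Suc t)
      then show ?case using wfr(1,4) unfolding wf_automaton_def dynamic_run.simps
        by (metis length_map)
    qed
    have head: "g (ps ! (i - 1)) t \<longleftrightarrow> ?q t = i" if i: "i \<in> {1..num_states A}" for i t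
    proof -
      have "ps ! (i - 1) \<in> head_vars r" using i wfr Dynamic by auto
      then have "g (ps ! (i - 1)) t \<longleftrightarrow>
          (\<exists>j\<in>{1..num_states A}. ps ! (i - 1) = ps ! (j - 1) \<and> ?q t = j)"
        using g[OF r] Dynamic by simp
      moreover have "ps ! (i - 1) = ps ! (j - 1) \<longleftrightarrow> i = j" if "j \<in> {1..num_states A}" for j
        using wfr i that by (subst nth_eq_iff_index_eq) auto
      ultimately show ?thesis using i by auto
    qed
    have "(\<exists>j\<in>{1..num_states A}. \<exists>\<sigma>. length \<sigma> = arity A \<and> delta A j \<sigma> = i \<and>
            g (ps ! (j - 1)) (t - 1) \<and> (\<forall>k<arity A. \<sigma> ! k \<longleftrightarrow> g (as ! k) t)) \<longleftrightarrow> ?q t = i"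
      (is "?L \<longleftrightarrow> _") if "t > 0" for i t
    proof -
      have \<sigma>: "length \<sigma> = arity A \<and> (\<forall>k<arity A. \<sigma> ! k \<longleftrightarrow> g (as ! k) t) \<longleftrightarrow> \<sigma> = ?x t" for \<sigma>
        using wfr(4) by (auto simp: list_eq_iff_nth_eq)
      have "?L \<longleftrightarrow> (\<exists>j\<in>{1..num_states A}. \<exists>\<sigma>. delta A j \<sigma> = i \<and> g (ps ! (j - 1)) (t - 1) \<and>
          (length \<sigma> = arity A \<and> (\<forall>k<arity A. \<sigma> ! k \<longleftrightarrow> g (as ! k) t)))"
        by blast
      also have "\<dots> \<longleftrightarrow> (\<exists>j\<in>{1..num_states A}. \<exists>\<sigma>. delta A j \<sigma> = i \<and> ?q (t - 1) = j \<and> \<sigma> = ?x t)"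
        unfolding \<sigma> by (intro bex_cong refl) (simp only: head)
      also have "\<dots> \<longleftrightarrow> delta A (?q (t - 1)) (?x t) = i" using q[of "t - 1"] by blast
      also have "\<dots> \<longleftrightarrow> ?q t = i" using that by (cases t) auto
      finally show ?thesis .
    qed
    then show ?thesis using Dynamic head by simp
  qed
  then have "prog_model P I (\<lambda>t. {p. g p t})"
    using input by (simp add: prog_model_def)
  then show ?thesis by blast
qed

lemma ex1_prog_model: "program P \<Longrightarrow> \<exists>!v. prog_model P I v"
  using prog_model_exists prog_model_unique by blast

definition prog_sat :: "'v rule set \<Rightarrow> 'v interp \<Rightarrow> nat \<Rightarrow> 'v \<Rightarrow> bool" where
  "prog_sat P I t p \<longleftrightarrow> p \<in> (THE v. prog_model P I v) t"

definition equivalent :: "'v pltl \<Rightarrow> 'v rule set \<Rightarrow> bool" where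
  "equivalent \<phi> P \<longleftrightarrow>
     (\<exists>p\<in>prog_vars P. \<forall>I t. I \<noteq> [] \<and> t \<in> {1..length I} \<longrightarrow>
        (prog_sat P I t p \<longleftrightarrow> pltl_sat I t \<phi>))"

end

theory Submission imports Defs begin

text \<open>
  Each connective adds one or two rules with fresh heads on top of a program that already computes
  the immediate subformulas, so acyclicity and definitoriality are preserved and the size grows by
  a constant. Static rules give the Boolean connectives and the since automaton gives since. A delay
  rule alone does not give before: it reads its argument at time 0, where for instance a negation
  may hold, whereas a before formula is false at time 1. Delaying the since of \<open>\<alpha>\<close> with itself
  repairs this, as that variable agrees with \<open>\<alpha>\<close> at positive times and is false at time 0.
\<close>

section \<open>Adding a rule with fresh heads to a program\<close>

lemma finite_prog_vars:
  assumes "finite P"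
  shows "finite (prog_vars P)"
proof -
  have "finite (set_static \<alpha>)" for \<alpha> :: "'a static" by (induction \<alpha>) auto
  then have "finite (head_vars r)" "finite (body_vars r)" for r :: "'a rule"
    by (cases r; simp)+
  then show ?thesis using assms by (simp add: prog_vars_def)
qed

lemma defined_subset_prog_vars: "defined_vars P \<subseteq> prog_vars P"
  by (auto simp: defined_vars_def prog_vars_def)

text \<open>No edge of the union leaves \<open>H\<close>: those of \<open>G\<close> do not by
  \<open>sinks\<close>, and those of \<open>B \<times> H\<close> start in \<open>B\<close>. A path
  therefore stays in \<open>G\<close> or ends in \<open>H\<close>. A cycle of the first kind
  contradicts acyclicity of \<open>G\<close>, and one through \<open>H\<close> would need an edge
  leaving \<open>H\<close>.\<close>

lemma acyclic_Un_Times_sinks: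
  assumes G: "acyclic G" and sinks: "H \<inter> Domain G = {}" and HB: "H \<inter> B = {}"
  shows "acyclic (B \<times> H \<union> G)"
proof (rule acyclicI, intro allI notI)
  have reach: "(x, y) \<in> G\<^sup>+ \<or> y \<in> H" if "(x, y) \<in> (B \<times> H \<union> G)\<^sup>+" for x y
    using that
  proof (induction rule: trancl_induct)
    case (base y)
    then show ?case by auto
  next
    case (step y z)
    then show ?case using sinks HB by (auto intro: trancl_into_trancl)
  qed
  fix x assume cyc: "(x, x) \<in> (B \<times> H \<union> G)\<^sup>+"
  then have "x \<in> H" using reach[OF cyc] G by (auto simp: acyclic_def)
  moreover obtain z where "(x, z) \<in> B \<times> H \<union> G" using tranclD[OF cyc] by blast
  ultimately show False using sinks HB by auto
qed

text \<open>Heads that occur neither in \<open>P\<close> nor in the new body become sinks of the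
  dependency graph. Avoiding only the heads of \<open>P\<close> would not do: a new head read by
  some old body could close a cycle.\<close>

lemma program_insert:
  assumes P: "program P" and wf: "rule_wf r"
    and fresh: "head_vars r \<inter> (prog_vars P \<union> body_vars r) = {}"
  shows "program (insert r P)"
proof -
  have "acyclic (body_vars r \<times> head_vars r \<union> dependency_graph P)"
  proof (rule acyclic_Un_Times_sinks)
    show "acyclic (dependency_graph P)" using P by (simp add: program_def nonrecursive_def)
  qed (use fresh in \<open>auto simp: dependency_graph_def prog_vars_def\<close>)
  then have "nonrecursive (insert r P)"
    by (simp add: nonrecursive_def dependency_graph_def)
  moreover have "head_vars r \<inter> head_vars r' = {}" if "r' \<in> P" for r'
    using fresh that by (auto simp: prog_vars_def)
  then have "definitorial (insert r P)"
    using P unfolding program_def definitorial_def by blast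
  ultimately show ?thesis using P wf by (simp add: program_def)
qed

section \<open>The since automaton computes since\<close>

lemma wf_since_automaton: "wf_automaton since_automaton"
proof -
  have "since_delta q \<sigma> \<in> {1..2}" if "q \<in> {1..2}" "length \<sigma> = 2" for q \<sigma>
    using that by (cases "(q, \<sigma>)" rule: since_delta.cases) auto
  then show ?thesis by (simp add: wf_automaton_def since_automaton_def)
qed

lemma obeys_since:
  assumes "obeys v (Dynamic [q1, q2] since_automaton [a, b])"
  shows "q2 \<notin> v 0"
    and "q2 \<in> v (Suc t) \<longleftrightarrow> b \<in> v (Suc t) \<or> a \<in> v (Suc t) \<and> q2 \<in> v t"
proof -
  let ?x = "\<lambda>t. [a \<in> v t, b \<in> v t]"
  have two: "{1..2} = {1, 2 :: nat}" by auto
  \<comment> \<open>Exactly one word matches the values of \<open>a\<close> and \<open>b\<close> at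
    a given time, which removes the quantifier over words from the semantics of the rule.\<close>
  have input: "length \<sigma> = 2 \<and> (\<forall>k<2. \<sigma> ! k \<longleftrightarrow> [a, b] ! k \<in> v t) \<longleftrightarrow> \<sigma> = ?x t" for \<sigma> t
    by (auto simp: length_Suc_conv numeral_2_eq_2 less_Suc_eq)
  have init: "[q1, q2] ! (i - 1) \<in> v 0 \<longleftrightarrow> 1 = i" if "i \<in> {1, 2}" for i
    using assms that unfolding obeys.simps since_automaton_def operator_automaton.simps two
    by blast
  have step: "[q1, q2] ! (i - 1) \<in> v (Suc t) \<longleftrightarrow>
      (\<exists>j\<in>{1, 2}. since_delta j (?x (Suc t)) = i \<and> [q1, q2] ! (j - 1) \<in> v t)"
    if "i \<in> {1, 2}" for i t
  proof -
    have "[q1, q2] ! (i - 1) \<in> v (Suc t) \<longleftrightarrow> (\<exists>j\<in>{1, 2}. \<exists>\<sigma>. length \<sigma> = 2 \<and>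
        since_delta j \<sigma> = i \<and> [q1, q2] ! (j - 1) \<in> v (Suc t - 1) \<and>
        (\<forall>k<2. \<sigma> ! k \<longleftrightarrow> [a, b] ! k \<in> v (Suc t)))"
      using assms that unfolding obeys.simps since_automaton_def operator_automaton.simps two
      by blast
    also have "\<dots> \<longleftrightarrow> (\<exists>j\<in>{1, 2}. \<exists>\<sigma>. (length \<sigma> = 2 \<and>
        (\<forall>k<2. \<sigma> ! k \<longleftrightarrow> [a, b] ! k \<in> v (Suc t))) \<and>
        since_delta j \<sigma> = i \<and> [q1, q2] ! (j - 1) \<in> v t)"
      unfolding diff_Suc_1 by blast
    finally show ?thesis unfolding input by simp
  qed
  have q1: "q1 \<in> v (Suc t) \<longleftrightarrow> b \<notin> v (Suc t) \<and>
      (if a \<in> v (Suc t) then q1 \<in> v t else q1 \<in> v t \<or> q2 \<in> v t)" for t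
    using step[of 1 t] by (cases "a \<in> v (Suc t)"; cases "b \<in> v (Suc t)") simp_all
  have q2: "q2 \<in> v (Suc t) \<longleftrightarrow> (if b \<in> v (Suc t) then q1 \<in> v t \<or> q2 \<in> v t
      else a \<in> v (Suc t) \<and> q2 \<in> v t)" for t
    using step[of 2 t] by (cases "a \<in> v (Suc t)"; cases "b \<in> v (Suc t)") simp_all
  show "q2 \<notin> v 0" using init[of 2] by simp
  \<comment> \<open>This half of the one-hot encoding suffices. When \<open>b\<close> holds, both
    states move to 2, so \<open>q2\<close> holds next provided that some state held before.\<close>
  have "q1 \<in> v t \<or> q2 \<in> v t" for t
  proof (induction t)
    case 0
    then show ?case using init[of 1] by simp
  next
    case (Suc t)
    then show ?case using q1[of t] q2[of t] by auto
  qed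
  then show "q2 \<in> v (Suc t) \<longleftrightarrow> b \<in> v (Suc t) \<or> a \<in> v (Suc t) \<and> q2 \<in> v t"
    using q2 by auto
qed

text \<open>Both sides are false at 0, where the interval is empty, and both satisfy the recursion
  of \<open>obeys_since\<close>: a witness \<open>j\<close> is either the last position or an
  earlier one, and then \<open>a\<close> holds at the last.\<close>

lemma obeys_since_iff:
  assumes "obeys v (Dynamic [q1, q2] since_automaton [a, b])"
  shows "q2 \<in> v t \<longleftrightarrow> (\<exists>j\<in>{1..t}. b \<in> v j \<and> (\<forall>k\<in>{j+1..t}. a \<in> v k))"
proof (induction t)
  case 0
  then show ?case using obeys_since(1)[OF assms] by simp
next
  case (Suc t)
  have "(\<exists>j\<in>{1..Suc t}. b \<in> v j \<and> (\<forall>k\<in>{j+1..Suc t}. a \<in> v k)) \<longleftrightarrow>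
      b \<in> v (Suc t) \<or> a \<in> v (Suc t) \<and> (\<exists>j\<in>{1..t}. b \<in> v j \<and> (\<forall>k\<in>{j+1..t}. a \<in> v k))"
    by (auto simp: atLeastAtMostSuc_conv)
  then show ?case using obeys_since(2)[OF assms] Suc by simp
qed

text \<open>
  The set \<open>V\<close> of input variables is fixed in advance, so that the fresh heads introduced for one
  subformula do not clash with the variables of a subformula translated later.
\<close>

definition since_program :: "'v set \<Rightarrow> 'v rule set \<Rightarrow> bool" where
  "since_program V P \<longleftrightarrow> P \<in> programs_over {since_automaton} \<and> defined_vars P \<inter> V = {}"

lemma finite_since_program: "since_program V P \<Longrightarrow> finite (prog_vars P)"
  by (simp add: since_program_def programs_over_def program_def finite_prog_vars)

text \<open>Unlike \<open>prog_model\<close>, this constrains no undefined variable outside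
  \<open>V\<close>. A model of a larger program is then also a model of the smaller one, which fails
  for \<open>prog_model\<close> when an added rule defines a variable that was undefined
  before.\<close>

definition input_model :: "'v set \<Rightarrow> 'v rule set \<Rightarrow> 'v interp \<Rightarrow> (nat \<Rightarrow> 'v set) \<Rightarrow> bool" where
  "input_model V P I v \<longleftrightarrow> (\<forall>x\<in>V. \<forall>t. x \<in> v t \<longleftrightarrow> x \<in> letter I t) \<and> (\<forall>r\<in>P. obeys v r)"

text \<open>Time 0 is left out because \<open>p\<close> may hold there without any meaning, as for a
  negation.\<close>

definition computes :: "'v set \<Rightarrow> 'v rule set \<Rightarrow> 'v \<Rightarrow> 'v pltl \<Rightarrow> bool" where
  "computes V P p \<phi> \<longleftrightarrow> p \<in> defined_vars P \<and>
     (\<forall>I v t. input_model V P I v \<longrightarrow> t \<ge> 1 \<longrightarrow> (p \<in> v t \<longleftrightarrow> pltl_sat I t \<phi>))"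

lemma input_model_mono: "input_model V Q I v \<Longrightarrow> P \<subseteq> Q \<Longrightarrow> input_model V P I v"
  by (auto simp: input_model_def)

lemma computes_mono:
  assumes "computes V P p \<phi>" and "P \<subseteq> Q"
  shows "computes V Q p \<phi>"
  unfolding computes_def
proof (intro conjI allI impI)
  show "p \<in> defined_vars Q" using assms by (auto simp: computes_def defined_vars_def)
next
  fix I v and t :: nat
  assume "input_model V Q I v" "t \<ge> 1"
  then show "p \<in> v t \<longleftrightarrow> pltl_sat I t \<phi>"
    using input_model_mono[OF _ assms(2)] assms(1) by (simp add: computes_def)
qed

lemma computesD:
  "computes V P p \<phi> \<Longrightarrow> input_model V P I v \<Longrightarrow> t \<ge> 1 \<Longrightarrow> p \<in> v t \<longleftrightarrow> pltl_sat I t \<phi>"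
  by (simp add: computes_def)

lemma computes_prog_vars: "computes V P p \<phi> \<Longrightarrow> p \<in> prog_vars P"
  by (rule subsetD[OF defined_subset_prog_vars]) (simp add: computes_def)

section \<open>Extending a program by the rules of one connective\<close>

text \<open>By \<open>fresh\<close> and \<open>body\<close> together, the heads of \<open>r\<close>
  avoid its own body, as \<open>program_insert\<close> requires.\<close>

lemma since_program_insert:
  assumes P: "since_program V P" and wf: "rule_wf r"
    and op: "\<And>ps A as. r = Dynamic ps A as \<Longrightarrow> A = since_automaton"
    and fresh: "head_vars r \<inter> (V \<union> prog_vars P) = {}"
    and body: "body_vars r \<subseteq> V \<union> prog_vars P"
  shows "since_program V (insert r P)" and "prog_size (insert r P) \<le> prog_size P + rule_size r"
proof -
  have prog: "program P" using P by (simp add: since_program_def programs_over_def)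
  have "program (insert r P)" using program_insert[OF prog wf] fresh body by blast
  moreover have "A = since_automaton" if "Dynamic ps A as \<in> insert r P" for ps A as
    using that
  proof
    assume "Dynamic ps A as = r"
    then show ?thesis using op by metis
  next
    assume "Dynamic ps A as \<in> P"
    then show ?thesis using P unfolding since_program_def programs_over_def by blast
  qed
  moreover have "defined_vars (insert r P) \<inter> V = {}"
    using P fresh by (auto simp: since_program_def defined_vars_def)
  ultimately show "since_program V (insert r P)"
    unfolding since_program_def programs_over_def by blast
  have "finite P" using prog by (simp add: program_def)
  then show "prog_size (insert r P) \<le> prog_size P + rule_size r"
    by (simp add: prog_size_def sum.insert_if)
qed

lemma extend_static:
  fixes P :: "'v rule set"
  assumes inf: "infinite (UNIV :: 'v set)" and V: "finite V" and P: "since_program V P"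
    and body: "set_static \<alpha> \<subseteq> V \<union> prog_vars P"
    and sat: "\<And>I v t. \<lbrakk>input_model V P I v; t \<ge> 1\<rbrakk>
      \<Longrightarrow> static_sat (v t) \<alpha> \<longleftrightarrow> pltl_sat I t \<phi>"
  shows "\<exists>Q p. P \<subseteq> Q \<and> since_program V Q \<and> computes V Q p \<phi> \<and>
    prog_size Q \<le> prog_size P + 1 + static_size \<alpha>"
proof -
  have "finite (V \<union> prog_vars P)"
    using V finite_since_program[OF P] by simp
  \<comment> \<open>The type of variables is infinite, so a finite program always leaves a fresh
    head.\<close>
  then obtain p where p: "p \<notin> V \<union> prog_vars P" using ex_new_if_finite[OF inf] by blast
  let ?Q = "insert (Static p \<alpha>) P"
  have "since_program V ?Q" "prog_size ?Q \<le> prog_size P + rule_size (Static p \<alpha>)"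
    by (rule since_program_insert[OF P]; use p body in simp)+
  moreover have "computes V ?Q p \<phi>"
    using sat by (auto simp: computes_def defined_vars_def input_model_def)
  ultimately show ?thesis by (intro exI[of _ ?Q] exI[of _ p]) auto
qed

text \<open>The shape of \<open>Q\<close> is exposed because before needs the value of
  \<open>q2\<close> at time 0, about which \<open>computes\<close> is silent. The cost 5 counts two
  heads, the operator and two arguments.\<close>

lemma extend_since:
  fixes P :: "'v rule set"
  assumes inf: "infinite (UNIV :: 'v set)" and V: "finite V" and P: "since_program V P"
    and a: "computes V P a \<alpha>" and b: "computes V P b \<beta>"
  obtains Q q1 q2 where "Q = insert (Dynamic [q1, q2] since_automaton [a, b]) P"
    and "since_program V Q" and "computes V Q q2 (Since \<alpha> \<beta>)"
    and "prog_size Q \<le> prog_size P + 5"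
proof -
  have fin: "finite (V \<union> prog_vars P)"
    using V finite_since_program[OF P] by simp
  obtain q1 where q1: "q1 \<notin> V \<union> prog_vars P" using ex_new_if_finite[OF inf fin] by blast
  have "finite (insert q1 (V \<union> prog_vars P))" using fin by simp
  then obtain q2 where q2: "q2 \<notin> insert q1 (V \<union> prog_vars P)"
    using ex_new_if_finite[OF inf] by blast
  let ?r = "Dynamic [q1, q2] since_automaton [a, b]"
  have wf: "rule_wf ?r" using q2 wf_since_automaton by (auto simp: since_automaton_def)
  have "computes V (insert ?r P) q2 (Since \<alpha> \<beta>)"
    unfolding computes_def
  proof (intro conjI allI impI)
    show "q2 \<in> defined_vars (insert ?r P)" by (simp add: defined_vars_def)
  next
    fix I v and t :: nat
    assume model: "input_model V (insert ?r P) I v"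
    then have P_model: "input_model V P I v" by (rule input_model_mono) blast
    have "obeys v ?r" using model unfolding input_model_def by blast
    note since = obeys_since_iff[OF this]
    \<comment> \<open>Since only consults positions from 1 on, so agreement of \<open>a\<close> and
      \<open>b\<close> at positive times is enough.\<close>
    have "a \<in> v t \<longleftrightarrow> pltl_sat I t \<alpha>" "b \<in> v t \<longleftrightarrow> pltl_sat I t \<beta>" if "t \<ge> 1" for t
      using computesD[OF a P_model that] computesD[OF b P_model that] .
    then show "q2 \<in> v t \<longleftrightarrow> pltl_sat I t (Since \<alpha> \<beta>)" by (simp add: since)
  qed
  moreover have "since_program V (insert ?r P)"
    "prog_size (insert ?r P) \<le> prog_size P + rule_size ?r"
    by (rule since_program_insert[OF P wf];
        use q1 q2 computes_prog_vars[OF a] computes_prog_vars[OF b] in force)+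
  ultimately show thesis using that[OF refl] by simp
qed

lemma extend_before:
  fixes P :: "'v rule set"
  assumes inf: "infinite (UNIV :: 'v set)" and V: "finite V" and P: "since_program V P"
    and a: "computes V P a \<alpha>"
  shows "\<exists>Q p. P \<subseteq> Q \<and> since_program V Q \<and> computes V Q p (Before \<alpha>) \<and>
    prog_size Q \<le> prog_size P + 8"
proof -
  obtain R q1 q2 where R_def: "R = insert (Dynamic [q1, q2] since_automaton [a, a]) P"
    and R: "since_program V R" and q2: "computes V R q2 (Since \<alpha> \<alpha>)"
    and size_R: "prog_size R \<le> prog_size P + 5"
    using extend_since[OF inf V P a a] .
  have "finite (V \<union> prog_vars R)"
    using V finite_since_program[OF R] by simp
  then obtain p where p: "p \<notin> V \<union> prog_vars R" using ex_new_if_finite[OF inf] by blast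
  let ?Q = "insert (Delay p q2) R"
  have "since_program V ?Q" "prog_size ?Q \<le> prog_size R + rule_size (Delay p q2)"
    by (rule since_program_insert[OF R]; use p computes_prog_vars[OF q2] in simp)+
  moreover have "computes V ?Q p (Before \<alpha>)"
    unfolding computes_def
  proof (intro conjI allI impI)
    show "p \<in> defined_vars ?Q" by (simp add: defined_vars_def)
  next
    fix I v and t :: nat
    assume model: "input_model V ?Q I v" and t: "t \<ge> 1"
    have "input_model V P I v" by (rule input_model_mono[OF model]) (auto simp: R_def)
    note sat = computesD[OF a this]
    have "obeys v (Dynamic [q1, q2] since_automaton [a, a])"
      using model unfolding R_def input_model_def by blast
    note gate = obeys_since[OF this]
    have "p \<in> v t \<longleftrightarrow> q2 \<in> v (t - 1)" using model t unfolding input_model_def by simp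
    \<comment> \<open>If \<open>t = 1\<close>, the delay reads \<open>q2\<close> at time 0, where it
      is false. Otherwise the recursion for \<open>q2\<close> with both arguments equal to
      \<open>a\<close> collapses to \<open>a\<close>.\<close>
    also have "\<dots> \<longleftrightarrow> t > 1 \<and> pltl_sat I (t - 1) \<alpha>"
      using gate sat by (cases "t - 1") auto
    finally show "p \<in> v t \<longleftrightarrow> pltl_sat I t (Before \<alpha>)" by simp
  qed
  ultimately show ?thesis using size_R R_def by (intro exI[of _ ?Q] exI[of _ p]) auto
qed

section \<open>Translation by induction on the formula\<close>

text \<open>Starting from an arbitrary \<open>P\<close> lets translations be stacked, with the bound
  limiting only the growth. The factor 8 is the cost of before, the most expensive connective: 5 for
  the dynamic rule and 3 for the delay.\<close>

definition compilable :: "'v set \<Rightarrow> 'v pltl \<Rightarrow> bool" where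
  "compilable V \<phi> \<longleftrightarrow> (\<forall>P. since_program V P \<longrightarrow> (\<exists>Q p. P \<subseteq> Q \<and> since_program V Q \<and>
     computes V Q p \<phi> \<and> prog_size Q \<le> prog_size P + 8 * pltl_size \<phi>))"

lemma compilableD:
  assumes "compilable V \<alpha>" and "since_program V P"
  obtains Q a where "P \<subseteq> Q" "since_program V Q" "computes V Q a \<alpha>"
    and "prog_size Q \<le> prog_size P + 8 * pltl_size \<alpha>"
  using assms unfolding compilable_def by blast

text \<open>The second subformula is translated on top of the first. A union of two independent
  translations might define the same head twice. The variable \<open>a\<close> keeps its meaning by
  \<open>computes_mono\<close>.\<close>

lemma compilableD2:
  assumes \<alpha>: "compilable V \<alpha>" and \<beta>: "compilable V \<beta>" and P: "since_program V P"
  obtains Q a b where "P \<subseteq> Q" "since_program V Q" "computes V Q a \<alpha>" "computes V Q b \<beta>"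
    and "prog_size Q \<le> prog_size P + 8 * pltl_size \<alpha> + 8 * pltl_size \<beta>"
proof -
  obtain Q a where Q: "P \<subseteq> Q" "since_program V Q" "computes V Q a \<alpha>"
    "prog_size Q \<le> prog_size P + 8 * pltl_size \<alpha>" using compilableD[OF \<alpha> P] .
  obtain R b where R: "Q \<subseteq> R" "since_program V R" "computes V R b \<beta>"
    "prog_size R \<le> prog_size Q + 8 * pltl_size \<beta>" using compilableD[OF \<beta> Q(2)] .
  show thesis
    by (rule that[of R a b]) (use Q R computes_mono[OF Q(3) R(1)] in auto)
qed

text \<open>Common scheme of the atomic and Boolean cases: \<open>Q\<close> handles the subformulas
  and one static rule with body \<open>\<alpha>\<close> is added on top.\<close>

lemma compilable_static:
  fixes \<phi> :: "'v pltl"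
  assumes inf: "infinite (UNIV :: 'v set)" and V: "finite V"
    and body: "\<And>P. since_program V P \<Longrightarrow> \<exists>Q \<alpha>. P \<subseteq> Q \<and> since_program V Q \<and>
      set_static \<alpha> \<subseteq> V \<union> prog_vars Q \<and>
      (\<forall>I v t. input_model V Q I v \<longrightarrow> t \<ge> 1 \<longrightarrow> (static_sat (v t) \<alpha> \<longleftrightarrow> pltl_sat I t \<phi>)) \<and>
      prog_size Q + 1 + static_size \<alpha> \<le> prog_size P + 8 * pltl_size \<phi>"
  shows "compilable V \<phi>"
  unfolding compilable_def
proof (intro allI impI)
  fix P assume "since_program V P"
  from body[OF this] obtain Q \<alpha> where Q: "P \<subseteq> Q" "since_program V Q"
    and vars: "set_static \<alpha> \<subseteq> V \<union> prog_vars Q"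
    and sat: "\<And>I v t. \<lbrakk>input_model V Q I v; t \<ge> 1\<rbrakk> \<Longrightarrow> static_sat (v t) \<alpha> \<longleftrightarrow> pltl_sat I t \<phi>"
    and size: "prog_size Q + 1 + static_size \<alpha> \<le> prog_size P + 8 * pltl_size \<phi>"
    by blast
  obtain R p where "Q \<subseteq> R" "since_program V R" "computes V R p \<phi>"
    "prog_size R \<le> prog_size Q + 1 + static_size \<alpha>"
    using extend_static[OF inf V Q(2) vars, of \<phi>] sat by blast
  then show "\<exists>R p. P \<subseteq> R \<and> since_program V R \<and> computes V R p \<phi> \<and>
      prog_size R \<le> prog_size P + 8 * pltl_size \<phi>"
    using Q size by (intro exI[of _ R] exI[of _ p]) auto
qed

lemma compilable:
  fixes \<phi> :: "'v pltl"
  assumes inf: "infinite (UNIV :: 'v set)" and V: "finite V"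
  shows "set_pltl \<phi> \<subseteq> V \<Longrightarrow> compilable V \<phi>"
proof (induction \<phi>)
  case (Var x)
  show ?case
  proof (rule compilable_static[OF inf V], goal_cases)
    case (1 P)
    \<comment> \<open>An input variable is copied by a static rule, since \<open>computes\<close>
      asks for a defined variable and \<open>x\<close> belongs to \<open>V\<close>, which no rule
      may define.\<close>
    then show ?case
      using Var by (intro exI[of _ P] exI[of _ "SVar x"]) (auto simp: input_model_def)
  qed
next
  case Top
  show ?case
  proof (rule compilable_static[OF inf V], goal_cases)
    case (1 P)
    then show ?case by (intro exI[of _ P] exI[of _ STop]) auto
  qed
next
  case Bot
  show ?case
  proof (rule compilable_static[OF inf V], goal_cases)
    case (1 P)
    then show ?case by (intro exI[of _ P] exI[of _ SBot]) auto
  qed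
next
  case (Neg \<alpha>)
  then have IH: "compilable V \<alpha>" by simp
  show ?case
  proof (rule compilable_static[OF inf V], goal_cases)
    case (1 P)
    obtain Q a where "P \<subseteq> Q" "since_program V Q" and a: "computes V Q a \<alpha>"
      and "prog_size Q \<le> prog_size P + 8 * pltl_size \<alpha>" using compilableD[OF IH 1] .
    then show ?case
      by (intro exI[of _ Q] exI[of _ "SNeg (SVar a)"])
        (simp add: computesD[OF a] computes_prog_vars[OF a])
  qed
next
  case (Conj \<alpha> \<beta>)
  then have IH: "compilable V \<alpha>" "compilable V \<beta>" by simp_all
  show ?case
  proof (rule compilable_static[OF inf V], goal_cases)
    case (1 P)
    obtain Q a b where "P \<subseteq> Q" "since_program V Q"
      and ab: "computes V Q a \<alpha>" "computes V Q b \<beta>"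
      and "prog_size Q \<le> prog_size P + 8 * pltl_size \<alpha> + 8 * pltl_size \<beta>"
      using compilableD2[OF IH 1] .
    then show ?case
      by (intro exI[of _ Q] exI[of _ "SConj (SVar a) (SVar b)"])
        (use ab[THEN computesD] ab[THEN computes_prog_vars] in simp)
  qed
next
  case (Disj \<alpha> \<beta>)
  then have IH: "compilable V \<alpha>" "compilable V \<beta>" by simp_all
  show ?case
  proof (rule compilable_static[OF inf V], goal_cases)
    case (1 P)
    obtain Q a b where "P \<subseteq> Q" "since_program V Q"
      and ab: "computes V Q a \<alpha>" "computes V Q b \<beta>"
      and "prog_size Q \<le> prog_size P + 8 * pltl_size \<alpha> + 8 * pltl_size \<beta>"
      using compilableD2[OF IH 1] .
    then show ?case
      by (intro exI[of _ Q] exI[of _ "SDisj (SVar a) (SVar b)"])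
        (use ab[THEN computesD] ab[THEN computes_prog_vars] in simp)
  qed
next
  case (Before \<alpha>)
  then have IH: "compilable V \<alpha>" by simp
  show ?case
    unfolding compilable_def
  proof (intro allI impI)
    fix P assume P: "since_program V P"
    obtain Q a where Q: "P \<subseteq> Q" "since_program V Q" and a: "computes V Q a \<alpha>"
      and size: "prog_size Q \<le> prog_size P + 8 * pltl_size \<alpha>" using compilableD[OF IH P] .
    obtain R p where "Q \<subseteq> R" "since_program V R" "computes V R p (Before \<alpha>)"
      "prog_size R \<le> prog_size Q + 8" using extend_before[OF inf V Q(2) a] by auto
    then show "\<exists>R p. P \<subseteq> R \<and> since_program V R \<and> computes V R p (Before \<alpha>) \<and>
        prog_size R \<le> prog_size P + 8 * pltl_size (Before \<alpha>)"
      using Q size by (intro exI[of _ R] exI[of _ p]) auto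
  qed
next
  case (Since \<alpha> \<beta>)
  then have IH: "compilable V \<alpha>" "compilable V \<beta>" by simp_all
  show ?case
    unfolding compilable_def
  proof (intro allI impI)
    fix P assume P: "since_program V P"
    obtain Q a b where Q: "P \<subseteq> Q" "since_program V Q"
      and ab: "computes V Q a \<alpha>" "computes V Q b \<beta>"
      and size: "prog_size Q \<le> prog_size P + 8 * pltl_size \<alpha> + 8 * pltl_size \<beta>"
      using compilableD2[OF IH P] .
    obtain R q1 q2 where "R = insert (Dynamic [q1, q2] since_automaton [a, b]) Q"
      and "since_program V R" "computes V R q2 (Since \<alpha> \<beta>)" "prog_size R \<le> prog_size Q + 5"
      using extend_since[OF inf V Q(2) ab] .
    then show "\<exists>R p. P \<subseteq> R \<and> since_program V R \<and> computes V R p (Since \<alpha> \<beta>) \<and>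
        prog_size R \<le> prog_size P + 8 * pltl_size (Since \<alpha> \<beta>)"
      using Q size by (intro exI[of _ R] exI[of _ q2]) auto
  qed
qed

theorem theorem11:
  assumes "infinite (UNIV :: 'v set)"
  shows "\<exists>c :: nat. \<forall>\<phi> :: 'v pltl. \<exists>P :: 'v rule set.
           P \<in> programs_over {since_automaton} \<and> equivalent \<phi> P \<and>
           prog_size P \<le> c * pltl_size \<phi>"
proof (intro exI[of _ 8] allI)
  fix \<phi> :: "'v pltl"
  let ?V = "set_pltl \<phi>"
  have V: "finite ?V" by (induction \<phi>) auto
  \<comment> \<open>Starting from the empty program, of size 0, turns the bound on growth into a
    bound on size.\<close>
  have empty: "since_program ?V {}"
    by (simp add: since_program_def programs_over_def program_def nonrecursive_def
        dependency_graph_def definitorial_def defined_vars_def acyclic_def)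
  obtain P p where "{} \<subseteq> P" and P: "since_program ?V P" and p: "computes ?V P p \<phi>"
    and "prog_size P \<le> prog_size ({} :: 'v rule set) + 8 * pltl_size \<phi>"
    using compilableD[OF compilable[OF assms V order_refl] empty] .
  then have size: "prog_size P \<le> 8 * pltl_size \<phi>" by (simp add: prog_size_def)
  have over: "P \<in> programs_over {since_automaton}" using P by (simp add: since_program_def)
  have "prog_sat P I t p \<longleftrightarrow> pltl_sat I t \<phi>" if "t \<ge> 1" for I t
  proof -
    have "program P" using over by (simp add: programs_over_def)
    then have "prog_model P I (THE v. prog_model P I v)" by (rule theI'[OF ex1_prog_model])
    \<comment> \<open>No rule of \<open>P\<close> defines a variable of the formula, so the unique
      model reads all of them from \<open>I\<close>.\<close>
    then have "input_model ?V P I (THE v. prog_model P I v)"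
      using P unfolding since_program_def prog_model_def input_model_def by blast
    then show ?thesis using computesD[OF p _ that] by (simp add: prog_sat_def)
  qed
  then have "equivalent \<phi> P"
    unfolding equivalent_def by (intro bexI[OF _ computes_prog_vars[OF p]]) auto
  then show "\<exists>P. P \<in> programs_over {since_automaton} \<and> equivalent \<phi> P \<and>
      prog_size P \<le> 8 * pltl_size \<phi>"
    using over size by blast
qed

end
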